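(* Let $N\ge 1$, let $a_j<b_j$ be real numbers for $j=1,\dots,N$, and let $\Omega=\prod_{j=1}^N[a_j,b_j]$. Then for any $\xi,\eta\in\Omega$, $$\delta_\Psi^2(\xi,\eta)\;\ge\; 2\sum_{j=1}^N\left(\frac{\eta_j-\xi_j}{b_j-a_j}\right)^2 .$$
   Context: Put $D_j=b_j-a_j$ and define, with the convention $0\ln 0=0$, the convex function $$\Psi(\xi)=\sum_{j=1}^N\left[\frac{\xi_j-a_j}{D_j}\ln\left(\frac{\xi_j-a_j}{D_j}\right)+\frac{b_j-\xi_j}{D_j}\ln\left(\frac{b_j-\xi_j}{D_j}\right)\right],\qquad \xi\in\Omega .$$ The Bregman divergence determined by $\Psi$ is $$\delta_\Psi^2(\xi,\eta)=\Psi(\xi)-\Psi(\eta)-\langle \xi-\eta,\nabla\Psi(\eta)\rangle ,$$ which for this $\Psi$ is given explicitly by $$\delta_\Psi^2(\xi,\eta)=\sum_{j=1}^N\left[\frac{\xi_j-a_j}{D_j}\ln\left(\frac{\xi_j-a_j}{\eta_j-a_j}\right)+\frac{b_j-\xi_j}{D_j}\ln\left(\frac{b_j-\xi_j}{b_j-\eta_j}\right)\right].$$ When $\eta$ lies on the boundary of $\Omega$, where $\nabla\Psi(\eta)$ does not exist, $\delta_\Psi^2(\xi,\eta)$ is understood through this explicit formula, with values in $[0,+\infty]$ and the usual conventions $0\ln(0/q)=0$ for $q\ge 0$ and $p\ln(p/0)=+\infty$ for $p>0$. The superscript $2$ in $\delta_\Psi^2$ is part of the notation. *)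

theory Defs
  imports "HOL-Analysis.Analysis"
begin

definition gradient :: "('v::real_inner \<Rightarrow> real) \<Rightarrow> 'v \<Rightarrow> 'v" where
  "gradient F x = (THE D. GDERIV F x :> D)"

definition bregman_divergence :: "('v::real_inner \<Rightarrow> real) \<Rightarrow> 'v \<Rightarrow> 'v \<Rightarrow> real" where
  "bregman_divergence F \<xi> \<eta> = F \<xi> - F \<eta> - (\<xi> - \<eta>) \<bullet> gradient F \<eta>"

text \<open>The convention \<open>0 ln 0 = 0\<close> is automatic below, since the coefficient of the logarithm
  vanishes. The values of this function outside \<open>cbox a b\<close> carry no meaning.\<close>

definition Psi :: "real ^ 'n::finite \<Rightarrow> real ^ 'n \<Rightarrow> real ^ 'n \<Rightarrow> real" where
  "Psi a b \<xi> = (\<Sum>j\<in>UNIV.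
     (\<xi> $ j - a $ j) / (b $ j - a $ j) * ln ((\<xi> $ j - a $ j) / (b $ j - a $ j)) +
     (b $ j - \<xi> $ j) / (b $ j - a $ j) * ln ((b $ j - \<xi> $ j) / (b $ j - a $ j)))"

text \<open>The extended real number \<open>p ln (p / q)\<close> for \<open>p, q \<ge> 0\<close>, with \<open>0 ln (0 / q) = 0\<close> for \<open>q \<ge> 0\<close>
  and \<open>p ln (p / 0) = \<infinity>\<close> for \<open>p > 0\<close>.\<close>

definition x_ln_ratio :: "real \<Rightarrow> real \<Rightarrow> ereal" where
  "x_ln_ratio p q = (if p = 0 then 0 else if q = 0 then \<infinity> else ereal (p * ln (p / q)))"

definition delta_Psi_explicit ::
    "real ^ 'n::finite \<Rightarrow> real ^ 'n \<Rightarrow> real ^ 'n \<Rightarrow> real ^ 'n \<Rightarrow> ereal" where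
  "delta_Psi_explicit a b \<xi> \<eta> = (\<Sum>j\<in>UNIV.
     x_ln_ratio (\<xi> $ j - a $ j) (\<eta> $ j - a $ j) / ereal (b $ j - a $ j) +
     x_ln_ratio (b $ j - \<xi> $ j) (b $ j - \<eta> $ j) / ereal (b $ j - a $ j))"

text \<open>For \<open>\<eta>\<close> on the boundary of the box the gradient of \<open>Psi a b\<close> does not exist, and the
  divergence is understood through the explicit formula.\<close>

definition delta_Psi_sq ::
    "real ^ 'n::finite \<Rightarrow> real ^ 'n \<Rightarrow> real ^ 'n \<Rightarrow> real ^ 'n \<Rightarrow> ereal" where
  "delta_Psi_sq a b \<xi> \<eta> =
     (if \<eta> \<in> interior (cbox a b) then ereal (bregman_divergence (Psi a b) \<xi> \<eta>)
      else delta_Psi_explicit a b \<xi> \<eta>)"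

end

theory Submission
  imports Defs
begin

text \<open>In the coordinates \<open>p = (\<xi>\<^sub>j - a\<^sub>j) / (b\<^sub>j - a\<^sub>j)\<close> and \<open>q = (\<eta>\<^sub>j - a\<^sub>j) / (b\<^sub>j - a\<^sub>j)\<close>, each
  summand of the divergence is the relative entropy
  \<open>p ln (p / q) + (1 - p) ln ((1 - p) / (1 - q))\<close> of two Bernoulli distributions, and each summand
  of the lower bound is \<open>2 (p - q)\<^sup>2\<close>. So the theorem is a sum of instances of the two-point
  Pinsker inequality (\<open>binary_pinsker\<close>). That inequality holds because, for fixed \<open>p\<close>, the
  difference of its two sides vanishes at \<open>q = p\<close> and has derivative
  \<open>(q - p) (1 / (q (1 - q)) - 4)\<close> in \<open>q\<close>, which has the sign of \<open>q - p\<close> since \<open>q (1 - q) \<le> 1/4\<close>.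

  For \<open>\<eta>\<close> in the interior the divergence is defined through the gradient of \<open>Psi a b\<close>. This gradient
  is computed in \<open>gradient_Psi\<close>, and inserting it gives the explicit formula
  (\<open>bregman_divergence_Psi\<close>), so that one estimate of the explicit formula serves both cases.
  A coordinate with \<open>q = 0\<close> or \<open>q = 1\<close> contributes infinity unless \<open>p = q\<close>.\<close>

text \<open>The half \<open>p \<le> q\<close> of the two-point Pinsker inequality, with the logarithms of the quotients
  split. The right-hand side is nondecreasing in \<open>q\<close> on \<open>[p, 1)\<close>, and the left-hand side is its
  value at \<open>q = p\<close>.\<close>

lemma cross_entropy_minus_square_mono:
  fixes p q :: real
  assumes "0 \<le> p" "p \<le> q" "q < 1"
  shows "- (p * ln p) - (1 - p) * ln (1 - p)
    \<le> - (p * ln q) - (1 - p) * ln (1 - q) - 2 * (q - p)\<^sup>2"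
proof -
  define g where "g t = - (p * ln t) - (1 - p) * ln (1 - t) - 2 * (t - p)\<^sup>2" for t
  have "g p \<le> g q"
  proof (rule DERIV_nonneg_imp_nondecreasing[OF assms(2)])
    fix t assume t: "p \<le> t" "t \<le> q"
    \<comment> \<open>For \<open>p = 0\<close> the logarithm of \<open>t\<close> is multiplied by zero, so \<open>t = 0\<close> does no harm.\<close>
    have "((\<lambda>t. p * ln t) has_real_derivative p / t) (at t)"
    proof (cases "p = 0")
      case False
      with assms t have "t > 0" by linarith
      then show ?thesis by (auto intro!: derivative_eq_intros)
    qed simp
    moreover have "((\<lambda>t. (1 - p) * ln (1 - t)) has_real_derivative - ((1 - p) / (1 - t))) (at t)"
      using t assms by (auto intro!: derivative_eq_intros)
    moreover have "((\<lambda>t. 2 * (t - p)\<^sup>2) has_real_derivative 4 * (t - p)) (at t)"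
      by (auto intro!: derivative_eq_intros)
    ultimately have deriv:
        "(g has_real_derivative - (p / t) - - ((1 - p) / (1 - t)) - 4 * (t - p)) (at t)"
      unfolding g_def[abs_def] by (rule DERIV_diff[OF DERIV_diff[OF DERIV_minus]])
    have "0 \<le> - (p / t) - - ((1 - p) / (1 - t)) - 4 * (t - p)"
    proof (cases "t = 0")
      case True
      then show ?thesis using t assms by simp
    next
      case False
      with assms t have pos: "0 < t" "0 < 1 - t" by linarith+
      have "- (p / t) - - ((1 - p) / (1 - t)) - 4 * (t - p) =
          (t - p) * (1 - 2 * t)\<^sup>2 / (t * (1 - t))"
        using pos by (simp add: divide_simps) (simp add: algebra_simps power2_eq_square)
      then show ?thesis using pos t by simp
    qed
    with deriv show "\<exists>y. (g has_real_derivative y) (at t) \<and> 0 \<le> y" by blast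
  qed
  then show ?thesis by (simp add: g_def)
qed

text \<open>The case \<open>q < p\<close> follows from the case \<open>p \<le> q\<close> by exchanging the two points of the
  probability space, that is, by passing to \<open>1 - p\<close> and \<open>1 - q\<close>.\<close>

lemma binary_pinsker_real:
  fixes p q :: real
  assumes p: "0 \<le> p" "p \<le> 1" and q: "0 < q" "q < 1"
  shows "2 * (q - p)\<^sup>2 \<le> p * ln (p / q) + (1 - p) * ln ((1 - p) / (1 - q))"
proof -
  have "- (p * ln p) - (1 - p) * ln (1 - p)
      \<le> - (p * ln q) - (1 - p) * ln (1 - q) - 2 * (q - p)\<^sup>2"
  proof (cases "p \<le> q")
    case True
    then show ?thesis using cross_entropy_minus_square_mono p q by blast
  next
    case False
    then show ?thesis
      using cross_entropy_minus_square_mono[of "1 - p" "1 - q"] p q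
      by (simp add: power2_commute)
  qed
  moreover have "p * ln (p / q) = p * ln p - p * ln q"
    using p q by (cases "p = 0") (auto simp: ln_div algebra_simps)
  moreover have "(1 - p) * ln ((1 - p) / (1 - q)) = (1 - p) * ln (1 - p) - (1 - p) * ln (1 - q)"
    using p q by (cases "p = 1") (auto simp: ln_div algebra_simps)
  ultimately show ?thesis by linarith
qed

lemma binary_pinsker:
  fixes p q :: real
  assumes "0 \<le> p" "p \<le> 1" "0 \<le> q" "q \<le> 1"
  shows "ereal (2 * (q - p)\<^sup>2) \<le> x_ln_ratio p q + x_ln_ratio (1 - p) (1 - q)"
proof (cases "0 < q \<and> q < 1")
  case True
  then show ?thesis
    using binary_pinsker_real[of p q] assms by (auto simp: x_ln_ratio_def)
next
  case False
  with assms consider "q = 0" | "q = 1" by linarith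
  then show ?thesis
    using assms by cases (auto simp: x_ln_ratio_def)
qed

lemma x_ln_ratio_divide:
  assumes "0 < D"
  shows "x_ln_ratio p q / ereal D = x_ln_ratio (p / D) (q / D)"
  using assms by (auto simp: x_ln_ratio_def)

text \<open>The passage to the normalised coordinate, in which the second pair of numbers is the
  complement to one of the first.\<close>

lemma delta_Psi_explicit_normalised:
  fixes a b \<xi> \<eta> :: "real ^ 'n::finite"
  assumes "\<And>j. a $ j < b $ j"
  shows "delta_Psi_explicit a b \<xi> \<eta> = (\<Sum>j\<in>UNIV.
    x_ln_ratio ((\<xi> $ j - a $ j) / (b $ j - a $ j)) ((\<eta> $ j - a $ j) / (b $ j - a $ j)) +
    x_ln_ratio (1 - (\<xi> $ j - a $ j) / (b $ j - a $ j)) (1 - (\<eta> $ j - a $ j) / (b $ j - a $ j)))"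
proof -
  have "(b $ j - x) / (b $ j - a $ j) = 1 - (x - a $ j) / (b $ j - a $ j)" for j x
    using assms[of j] by (simp add: field_simps)
  then show ?thesis
    using assms by (simp add: delta_Psi_explicit_def x_ln_ratio_divide)
qed

lemma delta_Psi_explicit_ge:
  fixes a b \<xi> \<eta> :: "real ^ 'n::finite"
  assumes less: "\<And>j. a $ j < b $ j" and \<xi>: "\<xi> \<in> cbox a b" and \<eta>: "\<eta> \<in> cbox a b"
  shows "ereal (2 * (\<Sum>j\<in>UNIV. ((\<eta> $ j - \<xi> $ j) / (b $ j - a $ j))\<^sup>2))
    \<le> delta_Psi_explicit a b \<xi> \<eta>"
proof -
  define u where "u x j = (x $ j - a $ j) / (b $ j - a $ j)" for x :: "real ^ 'n" and j
  have u: "0 \<le> u x j" "u x j \<le> 1" if "x \<in> cbox a b" for x j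
    using that less[of j] by (auto simp: u_def mem_box_cart)
  have "(\<eta> $ j - \<xi> $ j) / (b $ j - a $ j) = u \<eta> j - u \<xi> j" for j
    by (simp add: u_def diff_divide_distrib)
  then have "ereal (2 * (\<Sum>j\<in>UNIV. ((\<eta> $ j - \<xi> $ j) / (b $ j - a $ j))\<^sup>2))
      = (\<Sum>j\<in>UNIV. ereal (2 * (u \<eta> j - u \<xi> j)\<^sup>2))"
    by (simp add: sum_distrib_left)
  also have "\<dots> \<le> (\<Sum>j\<in>UNIV. x_ln_ratio (u \<xi> j) (u \<eta> j) + x_ln_ratio (1 - u \<xi> j) (1 - u \<eta> j))"
    using u \<xi> \<eta> by (intro sum_mono binary_pinsker)
  also have "\<dots> = delta_Psi_explicit a b \<xi> \<eta>"
    using less by (simp add: delta_Psi_explicit_normalised u_def)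
  finally show ?thesis .
qed

lemma gradient_eqI:
  assumes "GDERIV F x :> D"
  shows "gradient F x = D"
  unfolding gradient_def
proof (rule the_equality)
  show "GDERIV F x :> D" by (rule assms)
next
  fix D' assume "GDERIV F x :> D'"
  then have "(\<lambda>h. h \<bullet> D') = (\<lambda>h. h \<bullet> D)"
    using assms unfolding gderiv_def by (rule has_derivative_unique)
  then have "\<forall>h. h \<bullet> D' = h \<bullet> D" by (auto simp: fun_eq_iff)
  then show "D' = D" by (rule iffD1[OF vector_eq_ldot])
qed

lemma gradient_Psi:
  fixes a b \<eta> :: "real ^ 'n::finite"
  assumes "\<eta> \<in> box a b"
  shows "gradient (Psi a b) \<eta> = (\<chi> j.
    (ln ((\<eta> $ j - a $ j) / (b $ j - a $ j)) - ln ((b $ j - \<eta> $ j) / (b $ j - a $ j)))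
      / (b $ j - a $ j))"
    (is "_ = ?D")
proof -
  have "((\<lambda>x. (x $ j - a $ j) / (b $ j - a $ j) * ln ((x $ j - a $ j) / (b $ j - a $ j)) +
      (b $ j - x $ j) / (b $ j - a $ j) * ln ((b $ j - x $ j) / (b $ j - a $ j)))
      has_derivative (\<lambda>h. ?D $ j * h $ j)) (at \<eta>)" for j
  proof -
    define A B where "A = a $ j" and "B = b $ j"
    have pos: "0 < \<eta> $ j - A" "0 < B - \<eta> $ j" "0 < B - A"
      using assms unfolding A_def B_def mem_box_cart by (auto intro: less_trans)
    have D: "?D $ j = (ln ((\<eta> $ j - A) / (B - A)) + 1) / (B - A)
        + - ((ln ((B - \<eta> $ j) / (B - A)) + 1) / (B - A))"
      by (simp add: A_def B_def diff_divide_distrib add_divide_distrib)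
    have "((\<lambda>t. (t - A) / (B - A) * ln ((t - A) / (B - A))) has_real_derivative
        (ln ((\<eta> $ j - A) / (B - A)) + 1) / (B - A)) (at (\<eta> $ j))"
      using pos by (auto intro!: derivative_eq_intros simp: divide_simps)
    moreover have "((\<lambda>t. (B - t) / (B - A) * ln ((B - t) / (B - A))) has_real_derivative
        - ((ln ((B - \<eta> $ j) / (B - A)) + 1) / (B - A))) (at (\<eta> $ j))"
      using pos by (auto intro!: derivative_eq_intros simp: divide_simps) (simp add: algebra_simps)
    ultimately have "((\<lambda>t. (t - A) / (B - A) * ln ((t - A) / (B - A)) +
        (B - t) / (B - A) * ln ((B - t) / (B - A))) has_real_derivative ?D $ j) (at (\<eta> $ j))"
      unfolding D by (rule DERIV_add)
    then have "((\<lambda>t. (t - A) / (B - A) * ln ((t - A) / (B - A)) +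
        (B - t) / (B - A) * ln ((B - t) / (B - A))) has_derivative (\<lambda>h. ?D $ j * h)) (at (\<eta> $ j))"
      unfolding has_field_derivative_def .
    from has_derivative_compose[OF bounded_linear_imp_has_derivative[OF bounded_linear_vec_nth] this]
    show ?thesis unfolding A_def B_def .
  qed
  then have "(Psi a b has_derivative (\<lambda>h. \<Sum>j\<in>UNIV. ?D $ j * h $ j)) (at \<eta>)"
    unfolding Psi_def[abs_def] by (intro has_derivative_sum)
  then have "GDERIV (Psi a b) \<eta> :> ?D"
    by (simp only: gderiv_def inner_vec_def inner_real_def mult.commute)
  then show ?thesis by (rule gradient_eqI)
qed

text \<open>The logarithms of the normalised \<open>\<eta>\<close> come partly from \<open>Psi a b \<eta>\<close> and partly from the
  gradient; together their coefficients are \<open>- p\<close> and \<open>- (1 - p)\<close>, with \<open>p\<close> the normalised \<open>\<xi>\<close>, as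
  in the relative entropy.\<close>

lemma bregman_divergence_Psi:
  fixes a b \<xi> \<eta> :: "real ^ 'n::finite"
  assumes less: "\<And>j. a $ j < b $ j" and \<xi>: "\<xi> \<in> cbox a b" and \<eta>: "\<eta> \<in> box a b"
  shows "ereal (bregman_divergence (Psi a b) \<xi> \<eta>) = delta_Psi_explicit a b \<xi> \<eta>"
proof -
  define u where "u x j = (x $ j - a $ j) / (b $ j - a $ j)" for x :: "real ^ 'n" and j
  have compl: "(b $ j - x $ j) / (b $ j - a $ j) = 1 - u x j" for x j
    using less[of j] by (simp add: u_def field_simps)
  have u\<xi>: "0 \<le> u \<xi> j" "u \<xi> j \<le> 1" for j
    using \<xi> less[of j] by (auto simp: u_def mem_box_cart)
  have u\<eta>: "0 < u \<eta> j" "u \<eta> j < 1" for j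
    using \<eta> less[of j] by (auto simp: u_def mem_box_cart)
  have Psi: "Psi a b x = (\<Sum>j\<in>UNIV. u x j * ln (u x j) + (1 - u x j) * ln (1 - u x j))" for x
    unfolding Psi_def compl by (simp add: u_def)
  have "(\<xi> - \<eta>) \<bullet> gradient (Psi a b) \<eta>
      = (\<Sum>j\<in>UNIV. (u \<xi> j - u \<eta> j) * (ln (u \<eta> j) - ln (1 - u \<eta> j)))"
  proof -
    have "gradient (Psi a b) \<eta> $ j = (ln (u \<eta> j) - ln (1 - u \<eta> j)) / (b $ j - a $ j)" for j
      unfolding gradient_Psi[OF \<eta>] compl by (simp only: u_def vec_lambda_beta)
    moreover have "(\<xi> $ j - \<eta> $ j) * (c / (b $ j - a $ j)) = (u \<xi> j - u \<eta> j) * c" for j c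
      by (simp add: u_def diff_divide_distrib[symmetric])
    ultimately show ?thesis
      by (simp only: inner_vec_def inner_real_def vector_minus_component)
  qed
  then have "ereal (bregman_divergence (Psi a b) \<xi> \<eta>) = ereal (\<Sum>j\<in>UNIV.
      u \<xi> j * ln (u \<xi> j) + (1 - u \<xi> j) * ln (1 - u \<xi> j)
      - (u \<eta> j * ln (u \<eta> j) + (1 - u \<eta> j) * ln (1 - u \<eta> j))
      - (u \<xi> j - u \<eta> j) * (ln (u \<eta> j) - ln (1 - u \<eta> j)))" (is "_ = ereal ?S")
    by (simp add: bregman_divergence_def Psi sum_subtractf)
  also have "ereal ?S = (\<Sum>j\<in>UNIV. x_ln_ratio (u \<xi> j) (u \<eta> j) + x_ln_ratio (1 - u \<xi> j) (1 - u \<eta> j))"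
    unfolding sum_ereal[symmetric]
  proof (rule sum.cong[OF refl])
    fix j
    have "x_ln_ratio p q = ereal (p * ln p - p * ln q)" if "0 \<le> p" "0 < q" for p q
      using that by (auto simp: x_ln_ratio_def ln_div algebra_simps)
    then have "x_ln_ratio (u \<xi> j) (u \<eta> j) + x_ln_ratio (1 - u \<xi> j) (1 - u \<eta> j)
        = ereal ((u \<xi> j * ln (u \<xi> j) - u \<xi> j * ln (u \<eta> j))
          + ((1 - u \<xi> j) * ln (1 - u \<xi> j) - (1 - u \<xi> j) * ln (1 - u \<eta> j)))"
      using u\<xi>[of j] u\<eta>[of j] by simp
    then show "ereal (u \<xi> j * ln (u \<xi> j) + (1 - u \<xi> j) * ln (1 - u \<xi> j)
      - (u \<eta> j * ln (u \<eta> j) + (1 - u \<eta> j) * ln (1 - u \<eta> j))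
      - (u \<xi> j - u \<eta> j) * (ln (u \<eta> j) - ln (1 - u \<eta> j)))
      = x_ln_ratio (u \<xi> j) (u \<eta> j) + x_ln_ratio (1 - u \<xi> j) (1 - u \<eta> j)"
      by (simp add: algebra_simps)
  qed
  also have "\<dots> = delta_Psi_explicit a b \<xi> \<eta>"
    using less by (simp add: delta_Psi_explicit_normalised u_def)
  finally show ?thesis .
qed

theorem theorem2p2:
  fixes a b \<xi> \<eta> :: "real ^ 'n::finite"
  assumes "\<And>j. a $ j < b $ j"
    and "\<xi> \<in> cbox a b" and "\<eta> \<in> cbox a b"
  shows "delta_Psi_sq a b \<xi> \<eta> \<ge> ereal (2 * (\<Sum>j\<in>UNIV. ((\<eta> $ j - \<xi> $ j) / (b $ j - a $ j))\<^sup>2))"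
proof -
  have "delta_Psi_sq a b \<xi> \<eta> = delta_Psi_explicit a b \<xi> \<eta>"
    using bregman_divergence_Psi[OF assms(1,2)] by (simp add: delta_Psi_sq_def)
  then show ?thesis
    using delta_Psi_explicit_ge[OF assms] by simp
qed

end
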